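(* Consider a multitype Galton--Watson branching process with countable typeset $\mathcal X$ and a family $\mathcal A=\{A_i\}_{i\in K_{\mathcal A}}$ of subsets of $\mathcal X$ satisfying (C3): there are no $i\ne j$ in $K_{\mathcal A}$ with $A_i\Leftrightarrow A_j$. Then the map $g_{\mathcal A}:2^{K_{\mathcal A}}/_\sim\to\mathfrak I_{\mathcal A}$, $g_{\mathcal A}([I]_\sim)=(I_M,(I_c)^+)$, is bijective; in particular: (i) $|2^{K_{\mathcal A}}/_\sim|=|\mathfrak I_{\mathcal A}|$; (ii) if there are no ascending chains (i.e. $\mathfrak C_{\mathcal A}=\{\emptyset\}$), then the map $f_{\mathcal A}:\mathfrak P_{\mathcal A}\to2^{K_{\mathcal A}}/_\sim$, $f_{\mathcal A}(I)=[I]_\sim$, is bijective, that is, every equivalence class contains one (unique) primitive subset.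
   Context: A multitype Galton--Watson branching process (MGWBP) $\{\boldsymbol Z_n\}_{n\ge0}$ with countable (finite or countably infinite) typeset $\mathcal X$: $\boldsymbol Z_n=(Z_{n,x})_{x\in\mathcal X}$, where $Z_{n,x}$ is the number of type-$x$ individuals in generation $n$; each individual lives for one generation and at death, independently of all others, gives birth to a finite random number of offspring of various types, with a joint law depending only on its type. $\mathbb P_x$ denotes the law of the process started from a single type-$x$ individual. For $A\subseteq\mathcal X$, $\mathcal E(A)$ is the event $\lim_{n\to\infty}\sum_{x\in A}Z_{n,x}=0$ and $\mathcal S(A)=\mathcal E(A)^c$. For $A,B\subseteq\mathcal X$: $A\Rightarrow B$ means $\mathbb P_x(\mathcal S(A)\cap\mathcal E(B))=0$ for all $x\in\mathcal X$; $A\nRightarrow B$ is its negation; $A\Leftrightarrow B$ means $A\Rightarrow B$ and $B\Rightarrow A$; $A\nLeftrightarrow B$ means $A\nRightarrow B$ and $B\nRightarrow A$. $\mathcal A=\{A_i\}_{i\in K_{\mathcal A}}$, $A_i\subseteq\mathcal X$, $K_{\mathcal A}=\{1,\dots,\kappa_{\mathcal A}\}$, $\kappa_{\mathcal A}\le\infty$ (if $\kappa_{\mathcal A}=\infty$, $K_{\mathcal A}=\{1,2,3,\dots\}$). Equivalence relation on $2^{K_{\mathcal A}}$: $I\sim J$ iff for every $i\in I$ there exists $j\in J$ with $A_i\Rightarrow A_j$, and for every $j\in J$ there exists $i\in I$ with $A_j\Rightarrow A_i$; $[I]_\sim$ is the class of $I$. $I\subseteq K_{\mathcal A}$ is primitive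 if $A_i\nLeftrightarrow A_j$ for all $i\ne j$ in $I$; $\mathfrak P_{\mathcal A}$ is the set of primitive subsets (including $\emptyset$). For $I\subseteq K_{\mathcal A}$: $I_M=\{i\in I:\forall j\in I,\ j\ne i,\ A_i\nRightarrow A_j\}$, $I_d=\{i\in I:\exists j\in I_M,\ A_i\Rightarrow A_j\}$, $I_c=I\setminus I_d$, and $I^+=\{i\in K_{\mathcal A}:\exists j\in I,\ A_i\Rightarrow A_j\}$. An ascending chain is an infinite sequence $\{i_n\}_{n\ge0}$ of distinct elements of $K_{\mathcal A}$ with $A_{i_n}\Rightarrow A_{i_{n+1}}$ for all $n$. $\mathfrak C_{\mathcal A}=\{I\subseteq K_{\mathcal A}:\exists J\subseteq K_{\mathcal A},\ J=J_c,\ J^+=I\}$ (which contains $\emptyset$), and $$\mathfrak I_{\mathcal A}=\{(I,J)\in\mathfrak P_{\mathcal A}\times\mathfrak C_{\mathcal A}: I\cap J=\emptyset,\ (J\setminus I^+)^+=J\}.$$ *)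

theory Defs
  imports "HOL-Probability.Probability" "HOL-Library.Equipollence" "HOL-Library.Extended_Nat"
begin

text \<open>
  The typeset is a countable type \<open>'x\<close>. A generation, and likewise the offspring of one individual,
  is a finite multiset of types. Since there are only countably many such multisets, a
  \<^typ>\<open>'x multiset pmf\<close> is the most general joint law of a finite random offspring.
\<close>

instance multiset :: (countable) countable
proof
  have "countable (range (mset :: 'a list \<Rightarrow> 'a multiset))" by simp
  then have "countable (UNIV :: 'a multiset set)"
    by (metis ex_mset surj_def)
  then show "\<exists>to_nat :: 'a multiset \<Rightarrow> nat. inj to_nat"
    by (auto simp: countable_def)
qed

text \<open>
  All individuals reproduce independently: \<open>\<omega> (n, y, k)\<close> is the offspring of the \<open>k\<close>-th type-\<open>y\<close>
  individual of generation \<open>n\<close>, distributed according to \<open>p y\<close>.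
\<close>

definition reproduction_space ::
    "('x::countable \<Rightarrow> 'x multiset pmf) \<Rightarrow> (nat \<times> 'x \<times> nat \<Rightarrow> 'x multiset) measure" where
  "reproduction_space p = (\<Pi>\<^sub>M (n, y, k)\<in>UNIV. measure_pmf (p y))"

primrec generation :: "(nat \<times> 'x \<times> nat \<Rightarrow> 'x multiset) \<Rightarrow> 'x \<Rightarrow> nat \<Rightarrow> 'x multiset" where
  "generation \<omega> x 0 = {#x#}"
| "generation \<omega> x (Suc n) =
     (\<Sum>y\<in>set_mset (generation \<omega> x n). \<Sum>k<count (generation \<omega> x n) y. \<omega> (n, y, k))"

text \<open>The law \<open>\<P>\<^sub>x\<close> of the process started from one individual of type \<open>x\<close>, on the space of paths.\<close>

definition path_space :: "(nat \<Rightarrow> 'x multiset) measure" where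
  "path_space = (\<Pi>\<^sub>M n\<in>UNIV. count_space UNIV)"

definition gw_law ::
    "('x::countable \<Rightarrow> 'x multiset pmf) \<Rightarrow> 'x \<Rightarrow> (nat \<Rightarrow> 'x multiset) measure" where
  "gw_law p x = distr (reproduction_space p) path_space (\<lambda>\<omega>. generation \<omega> x)"

text \<open>
  The sum of \<open>Z\<^bsub>n,x\<^esub>\<close> over \<open>x \<in> A\<close> is restricted to the finitely many types that are present,
  because \<^const>\<open>sum\<close> over an infinite set is \<open>0\<close> by convention.
\<close>

definition population :: "'x set \<Rightarrow> 'x multiset \<Rightarrow> nat" where
  "population A Z = (\<Sum>x\<in>A \<inter> set_mset Z. count Z x)"

definition extinction :: "'x set \<Rightarrow> (nat \<Rightarrow> 'x multiset) set" where
  "extinction A = {Z. (\<lambda>n. population A (Z n)) \<longlonglongrightarrow> 0}"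

definition survival :: "'x set \<Rightarrow> (nat \<Rightarrow> 'x multiset) set" where
  "survival A = - extinction A"

text \<open>
  The next lemmas show that the laws are probability measures and that all extinction and survival
  events are measurable, so that no default value of \<^const>\<open>distr\<close> or \<^const>\<open>measure\<close> is involved below.
\<close>

lemma space_path_space [simp]: "space path_space = UNIV"
  by (simp add: path_space_def space_PiM)

lemma prob_space_reproduction_space: "prob_space (reproduction_space p)"
  unfolding reproduction_space_def
  by (rule prob_space_PiM) (auto split: prod.split intro: measure_pmf.prob_space_axioms)

lemma measurable_reproduction [measurable]:
  "(\<lambda>\<omega>. \<omega> i) \<in> measurable (reproduction_space p) (count_space UNIV)"
proof -
  have "(\<lambda>\<omega>. \<omega> i) \<in> measurable (reproduction_space p)
      ((\<lambda>(n, y, k). measure_pmf (p y)) i)"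
    unfolding reproduction_space_def by (rule measurable_component_singleton) simp
  moreover have "sets ((\<lambda>(n, y, k). measure_pmf (p y)) i) = sets (count_space UNIV)"
    by (cases i) simp
  ultimately show ?thesis
    using measurable_cong_sets[OF refl] by blast
qed

lemma measurable_multiset_sum:
  fixes f :: "'i \<Rightarrow> 'a \<Rightarrow> ('x::countable) multiset"
  assumes "\<And>i. f i \<in> measurable M (count_space UNIV)"
  shows "(\<lambda>\<omega>. \<Sum>i\<in>S. f i \<omega>) \<in> measurable M (count_space UNIV)"
proof (cases "finite S")
  case True
  then show ?thesis
  proof (induction S)
    case (insert a S)
    have "(\<lambda>\<omega>. (\<lambda>u \<omega>. u + (\<Sum>i\<in>S. f i \<omega>)) (f a \<omega>) \<omega>) \<in> measurable M (count_space UNIV)"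
    proof (rule measurable_compose_countable[OF _ assms])
      fix u
      show "(\<lambda>\<omega>. u + (\<Sum>i\<in>S. f i \<omega>)) \<in> measurable M (count_space UNIV)"
        by (rule measurable_compose[OF insert.IH]) simp
    qed
    then show ?case using insert.hyps by simp
  qed simp
qed simp

lemma measurable_generation:
  "(\<lambda>\<omega>. generation \<omega> x n) \<in> measurable (reproduction_space p) (count_space UNIV)"
proof (induction n)
  case (Suc n)
  have "(\<lambda>\<omega>. (\<lambda>Z \<omega>. \<Sum>y\<in>set_mset Z. \<Sum>k<count Z y. \<omega> (n, y, k)) (generation \<omega> x n) \<omega>)
      \<in> measurable (reproduction_space p) (count_space UNIV)"
    by (rule measurable_compose_countable[OF _ Suc])
      (intro measurable_multiset_sum measurable_reproduction)
  then show ?case by simp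
qed simp

lemma measurable_generations:
  "(\<lambda>\<omega>. generation \<omega> x) \<in> measurable (reproduction_space p) path_space"
  unfolding path_space_def
  by (rule measurable_PiM_single') (auto intro: measurable_generation)

lemma prob_space_gw_law: "prob_space (gw_law p x)"
  unfolding gw_law_def
  by (rule prob_space.prob_space_distr[OF prob_space_reproduction_space measurable_generations])

lemma sets_gw_law [simp]: "sets (gw_law p x) = sets path_space"
  by (simp add: gw_law_def)

lemma extinction_eventually:
  "extinction A = {Z. \<exists>N. \<forall>n\<ge>N. population A (Z n) = 0}"
  by (auto simp: extinction_def tendsto_discrete eventually_sequentially)

lemma sets_extinction: "extinction A \<in> sets path_space"
proof -
  have meas: "(\<lambda>Z. Z n) \<in> measurable path_space (count_space UNIV)" for n
    unfolding path_space_def by (rule measurable_component_singleton) simp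
  have [measurable]: "(\<lambda>Z. population A (Z n)) \<in> measurable path_space (count_space UNIV)" for n
    by (rule measurable_compose[OF meas]) simp
  have "{Z \<in> space path_space. \<exists>N. \<forall>n\<ge>N. population A (Z n) = 0} \<in> sets path_space"
    by measurable
  then show ?thesis by (simp add: extinction_eventually)
qed

lemma sets_survival: "survival A \<in> sets path_space"
  using sets.compl_sets[OF sets_extinction[of A]] by (simp add: survival_def Compl_eq_Diff_UNIV)


definition survival_implies ::
    "('x::countable \<Rightarrow> 'x multiset pmf) \<Rightarrow> 'x set \<Rightarrow> 'x set \<Rightarrow> bool" where
  "survival_implies p A B \<longleftrightarrow> (\<forall>x. measure (gw_law p x) (survival A \<inter> extinction B) = 0)"

definition equivalent ::
    "('x::countable \<Rightarrow> 'x multiset pmf) \<Rightarrow> 'x set \<Rightarrow> 'x set \<Rightarrow> bool" where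
  "equivalent p A B \<longleftrightarrow> survival_implies p A B \<and> survival_implies p B A"

text \<open>Incomparability is stronger than the negation of \<^const>\<open>equivalent\<close>.\<close>

definition incomparable ::
    "('x::countable \<Rightarrow> 'x multiset pmf) \<Rightarrow> 'x set \<Rightarrow> 'x set \<Rightarrow> bool" where
  "incomparable p A B \<longleftrightarrow> \<not> survival_implies p A B \<and> \<not> survival_implies p B A"


text \<open>
  A family indexed by \<open>{1, \<dots>, \<kappa>}\<close>, where \<open>\<kappa>\<close> may be infinite, is given by a function on all
  naturals; only its values on the index set are used.
\<close>

definition index_set :: "enat \<Rightarrow> nat set" where
  "index_set \<kappa> = {i. 1 \<le> i \<and> enat i \<le> \<kappa>}"

definition sim ::
    "('x::countable \<Rightarrow> 'x multiset pmf) \<Rightarrow> (nat \<Rightarrow> 'x set) \<Rightarrow> enat \<Rightarrow> (nat set \<times> nat set) set" where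
  "sim p A \<kappa> = {(I, J). I \<subseteq> index_set \<kappa> \<and> J \<subseteq> index_set \<kappa> \<and>
     (\<forall>i\<in>I. \<exists>j\<in>J. survival_implies p (A i) (A j)) \<and> (\<forall>j\<in>J. \<exists>i\<in>I. survival_implies p (A j) (A i))}"

definition index_classes ::
    "('x::countable \<Rightarrow> 'x multiset pmf) \<Rightarrow> (nat \<Rightarrow> 'x set) \<Rightarrow> enat \<Rightarrow> nat set set set" where
  "index_classes p A \<kappa> = Pow (index_set \<kappa>) // sim p A \<kappa>"

definition primitive_sets ::
    "('x::countable \<Rightarrow> 'x multiset pmf) \<Rightarrow> (nat \<Rightarrow> 'x set) \<Rightarrow> enat \<Rightarrow> nat set set" where
  "primitive_sets p A \<kappa> =
     {I. I \<subseteq> index_set \<kappa> \<and> (\<forall>i\<in>I. \<forall>j\<in>I. i \<noteq> j \<longrightarrow> incomparable p (A i) (A j))}"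

definition max_part ::
    "('x::countable \<Rightarrow> 'x multiset pmf) \<Rightarrow> (nat \<Rightarrow> 'x set) \<Rightarrow> nat set \<Rightarrow> nat set" where
  "max_part p A I = {i\<in>I. \<forall>j\<in>I. j \<noteq> i \<longrightarrow> \<not> survival_implies p (A i) (A j)}"

definition dominated_part ::
    "('x::countable \<Rightarrow> 'x multiset pmf) \<Rightarrow> (nat \<Rightarrow> 'x set) \<Rightarrow> nat set \<Rightarrow> nat set" where
  "dominated_part p A I = {i\<in>I. \<exists>j\<in>max_part p A I. survival_implies p (A i) (A j)}"

definition chain_part ::
    "('x::countable \<Rightarrow> 'x multiset pmf) \<Rightarrow> (nat \<Rightarrow> 'x set) \<Rightarrow> nat set \<Rightarrow> nat set" where
  "chain_part p A I = I - dominated_part p A I"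

definition plus_closure ::
    "('x::countable \<Rightarrow> 'x multiset pmf) \<Rightarrow> (nat \<Rightarrow> 'x set) \<Rightarrow> enat \<Rightarrow> nat set \<Rightarrow> nat set" where
  "plus_closure p A \<kappa> I = {i\<in>index_set \<kappa>. \<exists>j\<in>I. survival_implies p (A i) (A j)}"

definition ascending_chain ::
    "('x::countable \<Rightarrow> 'x multiset pmf) \<Rightarrow> (nat \<Rightarrow> 'x set) \<Rightarrow> enat \<Rightarrow> (nat \<Rightarrow> nat) \<Rightarrow> bool" where
  "ascending_chain p A \<kappa> s \<longleftrightarrow>
     range s \<subseteq> index_set \<kappa> \<and> inj s \<and> (\<forall>n. survival_implies p (A (s n)) (A (s (Suc n))))"

definition chain_sets ::
    "('x::countable \<Rightarrow> 'x multiset pmf) \<Rightarrow> (nat \<Rightarrow> 'x set) \<Rightarrow> enat \<Rightarrow> nat set set" where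
  "chain_sets p A \<kappa> = {I. I \<subseteq> index_set \<kappa> \<and>
     (\<exists>J\<subseteq>index_set \<kappa>. J = chain_part p A J \<and> plus_closure p A \<kappa> J = I)}"

definition index_pairs ::
    "('x::countable \<Rightarrow> 'x multiset pmf) \<Rightarrow> (nat \<Rightarrow> 'x set) \<Rightarrow> enat \<Rightarrow> (nat set \<times> nat set) set" where
  "index_pairs p A \<kappa> = {(I, J) \<in> primitive_sets p A \<kappa> \<times> chain_sets p A \<kappa>.
     I \<inter> J = {} \<and> plus_closure p A \<kappa> (J - plus_closure p A \<kappa> I) = J}"

text \<open>
  The map \<open>[I] \<mapsto> (I\<^sub>M, (I\<^sub>c)\<^sup>+)\<close> on classes: the value is the unique element of the image of the
  class, which is meaningful only once independence of the representative is established.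
\<close>

definition class_to_pair ::
    "('x::countable \<Rightarrow> 'x multiset pmf) \<Rightarrow> (nat \<Rightarrow> 'x set) \<Rightarrow> enat \<Rightarrow> nat set set
      \<Rightarrow> nat set \<times> nat set" where
  "class_to_pair p A \<kappa> C =
     the_elem ((\<lambda>I. (max_part p A I, plus_closure p A \<kappa> (chain_part p A I))) ` C)"

definition class_of ::
    "('x::countable \<Rightarrow> 'x multiset pmf) \<Rightarrow> (nat \<Rightarrow> 'x set) \<Rightarrow> enat \<Rightarrow> nat set \<Rightarrow> nat set set" where
  "class_of p A \<kappa> I = sim p A \<kappa> `` {I}"

end

theory Submission
  imports Defs
begin

text \<open>
  Survival implication is a preorder on sets of types, and (C3) makes it a partial order on the
  indices. Two index sets are similar iff they have the same down-closure \<open>I\<^sup>+\<close>, and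
  \<open>I\<^sup>+ = (I\<^sub>M)\<^sup>+ \<union> (I\<^sub>c)\<^sup>+\<close>, so the pair determines the class. Conversely a pair \<open>(P, J)\<close> is the
  image of the class of \<open>P \<union> (J - P\<^sup>+)\<close>. The sets \<open>I\<^sub>c\<close> have no maximal element, so a nonempty one
  yields an ascending chain by dependent choice.
\<close>

section \<open>Survival implication as a preorder\<close>

lemma survival_implies_refl: "survival_implies p X X"
  by (simp add: survival_implies_def survival_def)

text \<open>Split according to the fate of \<open>Y\<close>: if \<open>X\<close> survives while
  \<open>Z\<close> dies out, then either \<open>Y\<close> dies out although \<open>X\<close>
  survives, or \<open>Y\<close> survives although \<open>Z\<close> dies out. Both events are
  null.\<close>

lemma survival_implies_trans:
  assumes "survival_implies p X Y" "survival_implies p Y Z"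
  shows "survival_implies p X Z"
  unfolding survival_implies_def
proof
  fix x
  interpret prob_space "gw_law p x" by (rule prob_space_gw_law)
  let ?S = "survival X \<inter> extinction Y \<union> survival Y \<inter> extinction Z"
  have sets: "survival X \<inter> extinction Y \<in> events" "survival Y \<inter> extinction Z \<in> events"
    by (auto intro!: sets.Int sets_survival sets_extinction)
  have "prob (survival X \<inter> extinction Z) \<le> prob ?S"
    using sets by (intro finite_measure_mono sets.Un) (auto simp: survival_def)
  also have "\<dots> \<le> prob (survival X \<inter> extinction Y) + prob (survival Y \<inter> extinction Z)"
    using sets by (rule measure_Un_le)
  also have "\<dots> = 0"
    using assms by (simp add: survival_implies_def)
  finally show "prob (survival X \<inter> extinction Z) = 0"
    by (simp add: measure_le_0_iff)
qed

locale inequivalent_family =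
  fixes p :: "'x::countable \<Rightarrow> 'x multiset pmf"
    and A :: "nat \<Rightarrow> 'x set"
    and \<kappa> :: enat
  assumes C3: "\<not> (\<exists>i\<in>index_set \<kappa>. \<exists>j\<in>index_set \<kappa>. i \<noteq> j \<and> equivalent p (A i) (A j))"
begin

abbreviation K :: "nat set" where "K \<equiv> index_set \<kappa>"

abbreviation le :: "nat \<Rightarrow> nat \<Rightarrow> bool" (infix "\<preceq>" 50) where
  "i \<preceq> j \<equiv> survival_implies p (A i) (A j)"

abbreviation top_part :: "nat set \<Rightarrow> nat set" where "top_part \<equiv> max_part p A"

abbreviation topless_part :: "nat set \<Rightarrow> nat set" where "topless_part \<equiv> chain_part p A"

abbreviation down :: "nat set \<Rightarrow> nat set" where "down \<equiv> plus_closure p A \<kappa>"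

abbreviation cls :: "nat set \<Rightarrow> nat set set" where "cls \<equiv> class_of p A \<kappa>"

section \<open>The order on indices, down-closures and similarity\<close>

lemma le_refl: "i \<preceq> i"
  by (rule survival_implies_refl)

lemma le_trans: "i \<preceq> j \<Longrightarrow> j \<preceq> k \<Longrightarrow> i \<preceq> k"
  by (rule survival_implies_trans)

text \<open>This is the form in which (C3) enters the argument.\<close>

lemma le_antisym: "i \<in> K \<Longrightarrow> j \<in> K \<Longrightarrow> i \<preceq> j \<Longrightarrow> j \<preceq> i \<Longrightarrow> i = j"
  using C3 by (auto simp: equivalent_def)

lemma down_iff: "i \<in> down I \<longleftrightarrow> i \<in> K \<and> (\<exists>j\<in>I. i \<preceq> j)"
  by (simp add: plus_closure_def)

lemma down_subset: "down I \<subseteq> K"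
  by (auto simp: down_iff)

lemma subset_down: "I \<subseteq> K \<Longrightarrow> I \<subseteq> down I"
  unfolding subset_iff down_iff using le_refl by blast

lemma down_mono: "I \<subseteq> J \<Longrightarrow> down I \<subseteq> down J"
  unfolding subset_iff down_iff by blast

lemma down_closed: "i \<in> K \<Longrightarrow> i \<preceq> j \<Longrightarrow> j \<in> down I \<Longrightarrow> i \<in> down I"
  unfolding down_iff using le_trans by blast

lemma down_Un: "down (I \<union> J) = down I \<union> down J"
  by (auto simp: down_iff)

lemma down_idem: "down (down I) = down I"
proof
  show "down (down I) \<subseteq> down I"
    unfolding subset_iff down_iff[of _ "down I"] using down_closed by blast
  show "down I \<subseteq> down (down I)"
    by (rule subset_down[OF down_subset])
qed

lemma down_empty: "down {} = {}"
  by (simp add: plus_closure_def)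

text \<open>Similarity is mutual cofinality, and in a preorder cofinality of \<open>I\<close> in
  \<open>J\<close> is inclusion of the down-closures. Written as equality of an invariant, it is
  visibly an equivalence relation on the subsets of \<open>K\<close>.\<close>

lemma sim_iff: "(I, J) \<in> sim p A \<kappa> \<longleftrightarrow> I \<subseteq> K \<and> J \<subseteq> K \<and> down I = down J"
proof -
  have "(\<forall>i\<in>I. \<exists>j\<in>J. i \<preceq> j) \<longleftrightarrow> down I \<subseteq> down J" if "I \<subseteq> K" for I J
    using that le_refl le_trans unfolding subset_iff down_iff by metis
  then show ?thesis unfolding sim_def by blast
qed

lemma equiv_sim: "equiv (Pow K) (sim p A \<kappa>)"
  by (intro equivI refl_onI symI transI) (auto simp: sim_iff)

lemma mem_cls_iff: "J \<in> cls I \<longleftrightarrow> I \<subseteq> K \<and> J \<subseteq> K \<and> down I = down J"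
  by (simp add: class_of_def sim_iff)

lemma self_mem_cls: "I \<subseteq> K \<Longrightarrow> I \<in> cls I"
  by (simp add: mem_cls_iff)

lemma cls_eq_iff: "I \<subseteq> K \<Longrightarrow> J \<subseteq> K \<Longrightarrow> cls I = cls J \<longleftrightarrow> down I = down J"
  unfolding class_of_def using eq_equiv_class_iff[OF equiv_sim, of I J] by (simp add: sim_iff)

lemma index_classes_eq: "index_classes p A \<kappa> = cls ` Pow K"
  by (auto simp: index_classes_def quotient_def class_of_def)

section \<open>Maximal elements and the elements below none of them\<close>

lemma top_part_subset: "top_part I \<subseteq> I"
  by (auto simp: max_part_def)

lemma top_partD: "i \<in> top_part I \<Longrightarrow> j \<in> I \<Longrightarrow> i \<preceq> j \<Longrightarrow> j = i"
  by (auto simp: max_part_def)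

lemma topless_part_subset: "topless_part I \<subseteq> I"
  by (auto simp: chain_part_def)

lemma topless_part_iff: "i \<in> topless_part I \<longleftrightarrow> i \<in> I \<and> (\<forall>j\<in>top_part I. \<not> i \<preceq> j)"
  by (auto simp: chain_part_def dominated_part_def)

lemma topless_part_eq: "I \<subseteq> K \<Longrightarrow> topless_part I = I - down (top_part I)"
  by (auto simp: topless_part_iff down_iff)

text \<open>A maximal element lies below itself, hence is never topless, so nothing is removed
  exactly when no element is maximal.\<close>

lemma topless_part_fixed_iff: "topless_part I = I \<longleftrightarrow> top_part I = {}"
  unfolding set_eq_iff topless_part_iff using le_refl top_part_subset by blast

text \<open>Antisymmetry is essential: an equivalent index added by the closure would destroy the
  maximality of an old one. Together with \<open>down_topless_part_down\<close> this makes the pair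
  independent of the representative.\<close>

lemma top_part_down:
  assumes "I \<subseteq> K"
  shows "top_part (down I) = top_part I"
proof
  show "top_part I \<subseteq> top_part (down I)"
  proof
    fix i assume i: "i \<in> top_part I"
    then have "i \<in> I" "i \<in> K" using top_part_subset assms by auto
    moreover have "j = i" if "j \<in> down I" "i \<preceq> j" for j
    proof -
      obtain k where "k \<in> I" "j \<preceq> k" "j \<in> K" using \<open>j \<in> down I\<close> unfolding down_iff by blast
      \<comment> \<open>Maximality of \<open>i\<close> in \<open>I\<close> gives
        \<open>k = i\<close>, so \<open>j\<close> lies both above and below
        \<open>i\<close>.\<close>
      then show ?thesis
        using top_partD[OF i] le_trans that le_antisym \<open>i \<in> K\<close> by metis
    qed
    ultimately show "i \<in> top_part (down I)"
      using subset_down[OF assms] by (auto simp: max_part_def)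
  qed
  show "top_part (down I) \<subseteq> top_part I"
  proof
    fix i assume i: "i \<in> top_part (down I)"
    then obtain k where k: "k \<in> I" "i \<preceq> k"
      using top_part_subset by (force simp: down_iff)
    then have "i \<in> I"
      using top_partD[OF i] subset_down[OF assms] by blast
    then show "i \<in> top_part I"
      using top_partD[OF i] subset_down[OF assms] by (auto simp: max_part_def)
  qed
qed

text \<open>By transitivity, whatever lies above a topless element is below no maximal element
  either. Hence an element of \<open>I\<close> above a topless element of \<open>down I\<close> is
  itself topless in \<open>I\<close>.\<close>

lemma down_topless_part_down:
  assumes "I \<subseteq> K"
  shows "down (topless_part (down I)) = down (topless_part I)"
proof
  show "down (topless_part I) \<subseteq> down (topless_part (down I))"
    using subset_down[OF assms]
    by (intro down_mono) (auto simp: topless_part_iff top_part_down[OF assms])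
  have "topless_part (down I) \<subseteq> down (topless_part I)"
  proof
    fix i assume i: "i \<in> topless_part (down I)"
    then obtain j where "j \<in> I" "i \<preceq> j" "i \<in> K"
      unfolding topless_part_iff down_iff by blast
    moreover from this have "j \<in> topless_part I"
      using i le_trans unfolding topless_part_iff top_part_down[OF assms] by blast
    ultimately show "i \<in> down (topless_part I)"
      unfolding down_iff by blast
  qed
  then show "down (topless_part (down I)) \<subseteq> down (topless_part I)"
    using down_mono down_idem by metis
qed

section \<open>The pair map on representatives and on classes\<close>

definition pair :: "nat set \<Rightarrow> nat set \<times> nat set" where
  "pair I = (top_part I, down (topless_part I))"

lemma pair_cong: "I \<subseteq> K \<Longrightarrow> J \<subseteq> K \<Longrightarrow> down I = down J \<Longrightarrow> pair I = pair J"
  unfolding pair_def by (metis top_part_down down_topless_part_down)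

text \<open>\<open>pair\<close> is constant on a class, so its image there is a singleton and
  \<open>the_elem\<close> returns a genuine value rather than an unspecified one.\<close>

lemma class_to_pair_cls:
  assumes "I \<subseteq> K"
  shows "class_to_pair p A \<kappa> (cls I) = pair I"
proof -
  have "pair ` cls I = {pair I}"
  proof
    show "pair ` cls I \<subseteq> {pair I}"
    proof (rule image_subsetI)
      fix J assume "J \<in> cls I"
      then have "pair J = pair I"
        unfolding mem_cls_iff by (intro pair_cong) auto
      then show "pair J \<in> {pair I}" by simp
    qed
    show "{pair I} \<subseteq> pair ` cls I"
      using self_mem_cls[OF assms] by blast
  qed
  then show ?thesis by (simp only: class_to_pair_def pair_def[symmetric] the_elem_eq)
qed

text \<open>Each element of \<open>I\<close> is either below a maximal one or topless. Thus the pair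
  recovers \<open>down I\<close> and with it the class, which gives injectivity.\<close>

lemma down_decomposition:
  assumes "I \<subseteq> K"
  shows "down I = down (top_part I) \<union> down (topless_part I)"
proof
  have "I \<subseteq> down (top_part I) \<union> topless_part I"
    using topless_part_eq[OF assms] by auto
  then show "down I \<subseteq> down (top_part I) \<union> down (topless_part I)"
    using down_mono down_Un down_idem by metis
qed (use down_mono top_part_subset topless_part_subset in auto)

text \<open>The topless part is upward closed in \<open>I\<close>, so a maximal element of it would
  be maximal in \<open>I\<close> and then, lying below itself, not topless.\<close>

lemma top_part_topless_part: "top_part (topless_part I) = {}"
proof -
  have "i \<notin> top_part (topless_part I)" for i
  proof
    assume i: "i \<in> top_part (topless_part I)"
    then have *: "i \<in> topless_part I" using top_part_subset by blast
    then have "j \<in> topless_part I" if "j \<in> I" "i \<preceq> j" for j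
      using that le_trans by (auto simp: topless_part_iff)
    then have "i \<in> top_part I"
      using * top_partD[OF i] topless_part_subset by (auto simp: max_part_def)
    then show False using * le_refl by (auto simp: topless_part_iff)
  qed
  then show ?thesis by blast
qed

lemma chain_sets_iff: "J \<in> chain_sets p A \<kappa> \<longleftrightarrow> (\<exists>L\<subseteq>K. top_part L = {} \<and> J = down L)"
proof -
  have "J \<in> chain_sets p A \<kappa> \<longleftrightarrow> J \<subseteq> K \<and> (\<exists>L\<subseteq>K. top_part L = {} \<and> down L = J)"
    by (simp add: chain_sets_def topless_part_fixed_iff eq_commute[of _ "topless_part _"])
  then show ?thesis using down_subset by auto
qed

lemma top_part_primitive: "I \<subseteq> K \<Longrightarrow> top_part I \<in> primitive_sets p A \<kappa>"
  by (auto simp: max_part_def primitive_sets_def incomparable_def)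

lemma primitive_sets_subset: "P \<in> primitive_sets p A \<kappa> \<Longrightarrow> P \<subseteq> K"
  by (simp add: primitive_sets_def)

lemma top_part_of_primitive: "P \<in> primitive_sets p A \<kappa> \<Longrightarrow> top_part P = P"
  by (auto simp: max_part_def primitive_sets_def incomparable_def)

lemma pair_mem_index_pairs:
  assumes "I \<subseteq> K"
  shows "pair I \<in> index_pairs p A \<kappa>"
proof -
  let ?M = "top_part I" and ?C = "topless_part I"
  have C: "?C \<subseteq> K" using topless_part_subset assms by blast
  have "down ?C \<in> chain_sets p A \<kappa>"
    using C top_part_topless_part chain_sets_iff by blast
  \<comment> \<open>A maximal \<open>i\<close> below a topless \<open>j\<close> would have to equal
    \<open>j\<close>, but no maximal element is topless.\<close>
  moreover have "?M \<inter> down ?C = {}"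
    using top_partD le_refl topless_part_subset by (fastforce simp: down_iff topless_part_iff)
  moreover have "down (down ?C - down ?M) = down ?C"
  proof
    show "down (down ?C - down ?M) \<subseteq> down ?C"
      using down_mono[of "down ?C - down ?M" "down ?C"] down_idem by auto
    have "?C \<subseteq> down ?C - down ?M"
      using subset_down[OF C] topless_part_eq[OF assms] by auto
    then show "down ?C \<subseteq> down (down ?C - down ?M)" by (rule down_mono)
  qed
  ultimately show ?thesis
    using top_part_primitive[OF assms] by (simp add: pair_def index_pairs_def)
qed

text \<open>In the witness \<open>P \<union> (J - down P)\<close>, disjointness from the down-closed
  \<open>J\<close> keeps the elements of \<open>P\<close> maximal. Since \<open>J\<close> is the
  closure of a set without maximal elements, \<open>J - down P\<close> adds no further ones. The
  last condition on the pair then recovers \<open>J\<close> as the closure of the topless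
  part.\<close>

lemma index_pairs_realized:
  assumes "(P, J) \<in> index_pairs p A \<kappa>"
  obtains I where "I \<subseteq> K" "pair I = (P, J)"
proof
  let ?I = "P \<union> (J - down P)"
  have P: "P \<in> primitive_sets p A \<kappa>" and disj: "P \<inter> J = {}" and J: "down (J - down P) = J"
    using assms by (auto simp: index_pairs_def)
  obtain L where L: "L \<subseteq> K" "top_part L = {}" "J = down L"
    using assms by (auto simp: index_pairs_def chain_sets_iff)
  show sub: "?I \<subseteq> K"
    using primitive_sets_subset[OF P] L(3) down_subset by blast
  have top: "top_part ?I = P"
  proof
    show "P \<subseteq> top_part ?I"
    proof
      fix i assume i: "i \<in> P"
      then have "\<not> i \<preceq> j" if "j \<in> J" for j
        using that L(3) disj down_closed primitive_sets_subset[OF P] by blast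
      then show "i \<in> top_part ?I"
        using i P by (auto simp: max_part_def primitive_sets_def incomparable_def)
    qed
    show "top_part ?I \<subseteq> P"
    proof (rule subsetI, rule ccontr)
      fix i assume i: "i \<in> top_part ?I" "i \<notin> P"
      then have iJ: "i \<in> J" "i \<notin> down P" using top_part_subset by auto
      then obtain l where l: "l \<in> L" "i \<preceq> l" "i \<in> K" using L(3) by (auto simp: down_iff)
      then obtain l' where l': "l' \<in> L" "l' \<noteq> l" "l \<preceq> l'"
        using L(2) by (auto simp: max_part_def)
      \<comment> \<open>Such a \<open>k\<close> lies in \<open>J\<close>, and outside
        \<open>down P\<close> because \<open>i\<close> does, so it belongs to \<open>?I\<close> and
        maximality of \<open>i\<close> applies. Used for both \<open>l\<close> and
        \<open>l'\<close>, this contradicts \<open>l' \<noteq> l\<close>.\<close>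
      have above: "k = i" if "k \<in> L" "i \<preceq> k" for k
        using that top_partD[OF i(1), of k] subset_down[OF L(1)] L(3) iJ(2) l(3) down_closed
        by blast
      show False
        using above[OF l(1,2)] above[OF l'(1)] le_trans l l' by metis
    qed
  qed
  have "topless_part ?I = J - down P"
    using topless_part_eq[OF sub] subset_down[OF primitive_sets_subset[OF P]] top by auto
  then show "pair ?I = (P, J)" by (simp add: pair_def top J)
qed

lemma bij_class_to_pair:
  "bij_betw (class_to_pair p A \<kappa>) (index_classes p A \<kappa>) (index_pairs p A \<kappa>)"
proof (rule bij_betw_imageI)
  show "inj_on (class_to_pair p A \<kappa>) (index_classes p A \<kappa>)"
  proof (rule inj_onI)
    fix C D
    assume "C \<in> index_classes p A \<kappa>" "D \<in> index_classes p A \<kappa>"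
      and eq: "class_to_pair p A \<kappa> C = class_to_pair p A \<kappa> D"
    then obtain I J where IJ: "I \<subseteq> K" "J \<subseteq> K" "C = cls I" "D = cls J"
      by (auto simp: index_classes_eq)
    then have "pair I = pair J"
      using eq class_to_pair_cls by simp
    then show "C = D"
      using IJ by (simp add: cls_eq_iff pair_def down_decomposition)
  qed
  have "pair ` Pow K = index_pairs p A \<kappa>"
    using pair_mem_index_pairs index_pairs_realized by (auto simp: image_iff) (metis PowI)
  moreover have "class_to_pair p A \<kappa> ` index_classes p A \<kappa> = pair ` Pow K"
    unfolding index_classes_eq image_image by (rule image_cong) (auto simp: class_to_pair_cls)
  ultimately show "class_to_pair p A \<kappa> ` index_classes p A \<kappa> = index_pairs p A \<kappa>" by simp
qed

section \<open>Ascending chains and sets without maximal elements\<close>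

lemma ascending_chain_if_no_top:
  assumes "L \<subseteq> K" "top_part L = {}" "L \<noteq> {}"
  obtains s where "ascending_chain p A \<kappa> s"
proof -
  have "\<exists>j\<in>L. i \<preceq> j \<and> j \<noteq> i" if "i \<in> L" for i
    using that assms(2) by (auto simp: max_part_def)
  \<comment> \<open>Dependent choice only makes consecutive terms distinct; injectivity is derived
    below.\<close>
  then obtain s where s: "\<And>n. s n \<in> L" "\<And>n. s n \<preceq> s (Suc n) \<and> s (Suc n) \<noteq> s n"
    using dependent_nat_choice[of "\<lambda>_ i. i \<in> L" "\<lambda>_ i j. i \<preceq> j \<and> j \<noteq> i"] assms(3) by auto
  have mono: "s m \<preceq> s n" if "m \<le> n" for m n
    using that by (induction rule: dec_induct) (use le_refl s(2) le_trans in blast)+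
  have "s m \<noteq> s n" if "m < n" for m n
  proof
    \<comment> \<open>Here \<open>s (Suc m)\<close> is squeezed between \<open>s m\<close> and
      \<open>s n = s m\<close>, so antisymmetry would equate consecutive terms.\<close>
    assume "s m = s n"
    then have "s (Suc m) \<preceq> s m" using mono[of "Suc m" n] that by simp
    then show False using le_antisym s assms(1) by blast
  qed
  then have "inj s" by (metis injI linorder_neqE_nat)
  then have "ascending_chain p A \<kappa> s"
    using s assms(1) by (auto simp: ascending_chain_def)
  then show thesis by (rule that)
qed

lemma top_part_ascending_chain:
  assumes "ascending_chain p A \<kappa> s"
  shows "top_part (range s) = {}"
proof -
  have "s (Suc n) \<noteq> s n" for n
    using assms by (metis ascending_chain_def inj_eq n_not_Suc_n)
  then show ?thesis
    using assms by (fastforce simp: max_part_def ascending_chain_def)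
qed

lemma no_ascending_chain_iff:
  "(\<nexists>s. ascending_chain p A \<kappa> s) \<longleftrightarrow> chain_sets p A \<kappa> = {{}}"
proof
  assume none: "\<nexists>s. ascending_chain p A \<kappa> s"
  have "L = {}" if "L \<subseteq> K" "top_part L = {}" for L
    using that none ascending_chain_if_no_top by metis
  \<comment> \<open>This shows that \<open>{}\<close> is itself a chain set, so the collection is
    \<open>{{}}\<close> and not empty.\<close>
  moreover have "top_part {} = {}"
    using top_part_subset by blast
  ultimately have "J \<in> chain_sets p A \<kappa> \<longleftrightarrow> J = {}" for J
    unfolding chain_sets_iff using down_empty by (metis empty_subsetI)
  then show "chain_sets p A \<kappa> = {{}}" by blast
next
  assume trivial: "chain_sets p A \<kappa> = {{}}"
  show "\<nexists>s. ascending_chain p A \<kappa> s"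
  proof
    assume "\<exists>s. ascending_chain p A \<kappa> s"
    then obtain s where s: "ascending_chain p A \<kappa> s" by blast
    then have sub: "range s \<subseteq> K" by (simp add: ascending_chain_def)
    then have "down (range s) \<in> chain_sets p A \<kappa>"
      using top_part_ascending_chain[OF s] chain_sets_iff by blast
    \<comment> \<open>The closure contains the nonempty \<open>range s\<close>, so it is a chain set
      other than \<open>{}\<close>.\<close>
    then show False using trivial subset_down[OF sub] by auto
  qed
qed

section \<open>Primitive representatives\<close>

text \<open>A primitive set consists of the maximal elements of its own closure, so the closure
  determines it.\<close>

lemma primitive_unique:
  assumes "P \<in> primitive_sets p A \<kappa>" "Q \<in> primitive_sets p A \<kappa>" "down P = down Q"
  shows "P = Q"
  by (metis assms primitive_sets_subset top_part_down top_part_of_primitive)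

text \<open>A topless part has no maximal element, so without ascending chains it is empty. Hence
  \<open>top_part I\<close> is a primitive representative of the class of \<open>I\<close>.\<close>

lemma down_top_part_if_no_chain:
  assumes "\<nexists>s. ascending_chain p A \<kappa> s" "I \<subseteq> K"
  shows "down (top_part I) = down I"
proof -
  have "topless_part I \<subseteq> K"
    using topless_part_subset assms(2) by blast
  then have "topless_part I = {}"
    using ascending_chain_if_no_top top_part_topless_part assms(1) by metis
  then show ?thesis using down_decomposition[OF assms(2)] down_empty by simp
qed

lemma bij_cls_primitive:
  assumes "\<nexists>s. ascending_chain p A \<kappa> s"
  shows "bij_betw cls (primitive_sets p A \<kappa>) (index_classes p A \<kappa>)"
proof (rule bij_betw_imageI)
  show "inj_on cls (primitive_sets p A \<kappa>)"
    by (rule inj_onI) (metis cls_eq_iff primitive_sets_subset primitive_unique)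
  have "cls I \<in> cls ` primitive_sets p A \<kappa>" if "I \<subseteq> K" for I
    using cls_eq_iff[OF that, of "top_part I"] down_top_part_if_no_chain[OF assms that]
      top_part_primitive[OF that] primitive_sets_subset by (metis imageI)
  then show "cls ` primitive_sets p A \<kappa> = index_classes p A \<kappa>"
    using primitive_sets_subset by (auto simp: index_classes_eq)
qed

lemma ex1_primitive:
  assumes "\<nexists>s. ascending_chain p A \<kappa> s" "C \<in> index_classes p A \<kappa>"
  shows "\<exists>!I. I \<in> C \<and> I \<in> primitive_sets p A \<kappa>"
proof -
  obtain P where P: "P \<in> primitive_sets p A \<kappa>" "C = cls P"
    using bij_betw_imp_surj_on[OF bij_cls_primitive[OF assms(1)]] assms(2) by blast
  then have "P \<in> C" using self_mem_cls primitive_sets_subset by blast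
  then show ?thesis
    using P primitive_unique mem_cls_iff by metis
qed

end

theorem proposition2:
  fixes p :: "'x::countable \<Rightarrow> 'x multiset pmf"
    and A :: "nat \<Rightarrow> 'x set"
    and \<kappa> :: enat
  assumes C3: "\<not> (\<exists>i\<in>index_set \<kappa>. \<exists>j\<in>index_set \<kappa>. i \<noteq> j \<and> equivalent p (A i) (A j))"
  shows
    "(\<forall>I\<subseteq>index_set \<kappa>. class_to_pair p A \<kappa> (class_of p A \<kappa> I) =
        (max_part p A I, plus_closure p A \<kappa> (chain_part p A I))) \<and>
     bij_betw (class_to_pair p A \<kappa>) (index_classes p A \<kappa>) (index_pairs p A \<kappa>) \<and>
     index_classes p A \<kappa> \<approx> index_pairs p A \<kappa> \<and>
     ((\<nexists>s. ascending_chain p A \<kappa> s) \<longleftrightarrow> chain_sets p A \<kappa> = {{}}) \<and>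
     ((\<nexists>s. ascending_chain p A \<kappa> s) \<longrightarrow>
        bij_betw (class_of p A \<kappa>) (primitive_sets p A \<kappa>) (index_classes p A \<kappa>) \<and>
        (\<forall>C\<in>index_classes p A \<kappa>. \<exists>!I. I \<in> C \<and> I \<in> primitive_sets p A \<kappa>))"
proof -
  interpret inequivalent_family p A \<kappa>
    using C3 by unfold_locales
  show ?thesis
  proof (intro conjI)
    show "\<forall>I\<subseteq>K. class_to_pair p A \<kappa> (cls I) = (top_part I, down (topless_part I))"
      using class_to_pair_cls unfolding pair_def by blast
    show "index_classes p A \<kappa> \<approx> index_pairs p A \<kappa>"
      unfolding eqpoll_def using bij_class_to_pair by blast
    show "(\<nexists>s. ascending_chain p A \<kappa> s) \<longrightarrow>
        bij_betw cls (primitive_sets p A \<kappa>) (index_classes p A \<kappa>) \<and>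
        (\<forall>C\<in>index_classes p A \<kappa>. \<exists>!I. I \<in> C \<and> I \<in> primitive_sets p A \<kappa>)"
      by (intro impI conjI ballI bij_cls_primitive ex1_primitive)
  qed (fact bij_class_to_pair no_ascending_chain_iff)+
qed

end
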